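(* For $k=1,2$, let $G_k=(V_k,E_k)$ be a directed graph with $q_k$ vertices, with a proper surjective edge coloring $c_k:E_k\to S_k$, $|S_k|=p_k$, and suppose $G_1$ and $G_2$ are disjoint. Let $\mathfrak{n}_1$ and $\mathfrak{n}_2$ be the corresponding Lie algebras, with corresponding bases $V_1\cup S_1=\{v_i\}_{i=1}^{q_1}\cup\{z_j\}_{j=1}^{p_1}$ and $V_2\cup S_2=\{x_i\}_{i=1}^{q_2}\cup\{w_j\}_{j=1}^{p_2}$ respectively. Let $\mathfrak{n}$ be the Lie algebra corresponding to the colored graph $G_1+G_2$. Let $\mathfrak{i}$ be the ideal of $\mathfrak{n}_1\oplus\mathfrak{n}_2$ defined by $$\mathfrak{i}=\operatorname{span}\{(z_i,-w_j): z_i=w_j\}$$ if $S_1\cap S_2\neq\emptyset$, and $\mathfrak{i}=\{(0,0)\}$ otherwise. Then $$\mathfrak{n}\cong(\mathfrak{n}_1\oplus\mathfrak{n}_2)/\mathfrak{i}.$$ In particular, if $S_1$ and $S_2$ are disjoint, then $\mathfrak{n}\cong\mathfrak{n}_1\oplus\mathfrak{n}_2$.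
   Context: Directed graphs here arise from orienting finite simple undirected graphs: no loops or multiple edges, and $(v,w)$, $(w,v)$ are never both edges. An edge coloring is proper if adjacent edges have different colors. Lie algebras are over $\mathbb{R}$. The Lie algebra corresponding to a directed graph $(V,E)$ with edge coloring $c:E\to S$ is the real vector space with basis $V\cup S$ (disjoint union) and bilinear bracket determined by: $[v,w]=c(v,w)$ if $(v,w)\in E$; $[v,w]=-c(w,v)$ if $(w,v)\in E$; $[v,w]=0$ for other $v,w\in V$; and all brackets involving an element of $S$ are zero. The graph $G_1+G_2=(V_1\cup V_2,E_1\cup E_2)$ is the disjoint union, with coloring $c:E_1\cup E_2\to S_1\cup S_2$ given by $c(e)=c_1(e)$ for $e\in E_1$ and $c(e)=c_2(e)$ for $e\in E_2$. The condition $z_i=w_j$ means that $z_i\in S_1$ and $w_j\in S_2$ are the same color. *)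

theory Defs
  imports "Graph_Theory.Pair_Digraph" "Jordan_Normal_Form.VS_Connect" "HOL-Algebra.QuotRing"
begin

section \<open>Real Lie algebras on explicit carriers\<close>

text \<open>
  The underlying vector space is a HOL-Algebra module record over \<^term>\<open>class_ring :: real ring\<close>.
  The fields \<^const>\<open>monoid.mult\<close> and \<^const>\<open>one\<close> inherited from the ring record play no role.
\<close>

record 'a lie_alg = "(real, 'a) module" +
  lie_bracket :: "'a \<Rightarrow> 'a \<Rightarrow> 'a"

locale lie_algebra = vectorspace class_ring L
  for L :: "('a, 'm) lie_alg_scheme" (structure) +
  assumes bracket_closed:
      "\<lbrakk>x \<in> carrier L; y \<in> carrier L\<rbrakk> \<Longrightarrow> lie_bracket L x y \<in> carrier L"
    and bracket_add_left:
      "\<lbrakk>x \<in> carrier L; y \<in> carrier L; z \<in> carrier L\<rbrakk> \<Longrightarrow>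
        lie_bracket L (x \<oplus>\<^bsub>L\<^esub> y) z = lie_bracket L x z \<oplus>\<^bsub>L\<^esub> lie_bracket L y z"
    and bracket_add_right:
      "\<lbrakk>x \<in> carrier L; y \<in> carrier L; z \<in> carrier L\<rbrakk> \<Longrightarrow>
        lie_bracket L x (y \<oplus>\<^bsub>L\<^esub> z) = lie_bracket L x y \<oplus>\<^bsub>L\<^esub> lie_bracket L x z"
    and bracket_smult_left:
      "\<lbrakk>x \<in> carrier L; y \<in> carrier L\<rbrakk> \<Longrightarrow>
        lie_bracket L (a \<odot>\<^bsub>L\<^esub> x) y = a \<odot>\<^bsub>L\<^esub> lie_bracket L x y"
    and bracket_smult_right:
      "\<lbrakk>x \<in> carrier L; y \<in> carrier L\<rbrakk> \<Longrightarrow>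
        lie_bracket L x (a \<odot>\<^bsub>L\<^esub> y) = a \<odot>\<^bsub>L\<^esub> lie_bracket L x y"
    and bracket_self: "x \<in> carrier L \<Longrightarrow> lie_bracket L x x = \<zero>\<^bsub>L\<^esub>"
    and jacobi:
      "\<lbrakk>x \<in> carrier L; y \<in> carrier L; z \<in> carrier L\<rbrakk> \<Longrightarrow>
        lie_bracket L x (lie_bracket L y z) \<oplus>\<^bsub>L\<^esub> lie_bracket L y (lie_bracket L z x)
          \<oplus>\<^bsub>L\<^esub> lie_bracket L z (lie_bracket L x y) = \<zero>\<^bsub>L\<^esub>"

definition lie_ideal :: "'a set \<Rightarrow> 'a lie_alg \<Rightarrow> bool" where
  "lie_ideal I L \<longleftrightarrow> VectorSpace.subspace class_ring I L \<and>
     (\<forall>x\<in>carrier L. \<forall>y\<in>I. lie_bracket L x y \<in> I)"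

definition lie_direct_sum :: "'a lie_alg \<Rightarrow> 'b lie_alg \<Rightarrow> ('a \<times> 'b) lie_alg" where
  "lie_direct_sum L M = module.extend (direct_sum L M)
     \<lparr>lie_bracket = (\<lambda>v w. (lie_bracket L (fst v) (fst w), lie_bracket M (snd v) (snd w)))\<rparr>"

text \<open>
  Elements are the cosets \<open>I +> x\<close>. As for \<^const>\<open>rcoset_mult\<close>, the operations are unions over
  all representatives; for an ideal they are single cosets (see \<open>lie_quotient_ops\<close> below).
\<close>

definition lie_quotient :: "'a lie_alg \<Rightarrow> 'a set \<Rightarrow> 'a set lie_alg" where
  "lie_quotient L I = ring.extend (L Quot I)
     \<lparr>smult = (\<lambda>a X. \<Union>x\<in>X. I +>\<^bsub>L\<^esub> (a \<odot>\<^bsub>L\<^esub> x)),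
      lie_bracket = (\<lambda>X Y. \<Union>x\<in>X. \<Union>y\<in>Y. I +>\<^bsub>L\<^esub> lie_bracket L x y)\<rparr>"

definition lie_iso :: "'a lie_alg \<Rightarrow> 'b lie_alg \<Rightarrow> ('a \<Rightarrow> 'b) set" where
  "lie_iso L M = {h. h \<in> LinearCombinations.module_hom class_ring L M \<and>
     (\<forall>x\<in>carrier L. \<forall>y\<in>carrier L. h (lie_bracket L x y) = lie_bracket M (h x) (h y)) \<and>
     bij_betw h (carrier L) (carrier M)}"

definition lie_isomorphic :: "'a lie_alg \<Rightarrow> 'b lie_alg \<Rightarrow> bool" where
  "lie_isomorphic L M \<longleftrightarrow> lie_iso L M \<noteq> {}"


section \<open>Edge-colored directed graphs\<close>

locale oriented_graph = pair_digraph G for G :: "'v pair_pre_digraph" +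
  assumes no_antiparallel: "(v, w) \<in> parcs G \<Longrightarrow> (w, v) \<notin> parcs G"

text \<open>Edges are adjacent if they share an endpoint, irrespective of orientation.\<close>

definition proper_edge_coloring :: "'v pair_pre_digraph \<Rightarrow> ('v \<times> 'v \<Rightarrow> 's) \<Rightarrow> bool" where
  "proper_edge_coloring G c \<longleftrightarrow>
     (\<forall>e\<in>parcs G. \<forall>f\<in>parcs G.
        e \<noteq> f \<and> {fst e, snd e} \<inter> {fst f, snd f} \<noteq> {} \<longrightarrow> c e \<noteq> c f)"

definition graph_sum :: "'v pair_pre_digraph \<Rightarrow> 'v pair_pre_digraph \<Rightarrow> 'v pair_pre_digraph" where
  "graph_sum G1 G2 = \<lparr>pverts = pverts G1 \<union> pverts G2, parcs = parcs G1 \<union> parcs G2\<rparr>"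

definition sum_coloring ::
    "'v pair_pre_digraph \<Rightarrow> ('v \<times> 'v \<Rightarrow> 's) \<Rightarrow> ('v \<times> 'v \<Rightarrow> 's) \<Rightarrow> 'v \<times> 'v \<Rightarrow> 's" where
  "sum_coloring G1 c1 c2 e = (if e \<in> parcs G1 then c1 e else c2 e)"


section \<open>The Lie algebra of an edge-colored directed graph\<close>

text \<open>
  The vector space with (finite) basis \<open>V \<union> S\<close> is the space of coordinate functions on the
  tagged disjoint union of \<open>V\<close> and \<open>S\<close>, set to \<open>0\<close> outside it; \<open>basis_vec b\<close> is the vector
  representing the basis element \<open>b\<close>.
\<close>

definition graph_basis :: "'v pair_pre_digraph \<Rightarrow> 's set \<Rightarrow> ('v + 's) set" where
  "graph_basis G S = Inl ` pverts G \<union> Inr ` S"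

definition basis_vec :: "'b \<Rightarrow> 'b \<Rightarrow> real" where
  "basis_vec b = (\<lambda>x. if x = b then 1 else 0)"

fun basis_bracket ::
    "'v pair_pre_digraph \<Rightarrow> ('v \<times> 'v \<Rightarrow> 's) \<Rightarrow> 'v + 's \<Rightarrow> 'v + 's \<Rightarrow> 'v + 's \<Rightarrow> real" where
  "basis_bracket G c (Inl v) (Inl w) =
     (if (v, w) \<in> parcs G then basis_vec (Inr (c (v, w)))
      else if (w, v) \<in> parcs G then (\<lambda>x. - basis_vec (Inr (c (w, v))) x)
      else (\<lambda>x. 0))"
| "basis_bracket G c (Inr s) b = (\<lambda>x. 0)"
| "basis_bracket G c a (Inr s) = (\<lambda>x. 0)"

definition graph_lie_algebra ::
    "'v pair_pre_digraph \<Rightarrow> 's set \<Rightarrow> ('v \<times> 'v \<Rightarrow> 's) \<Rightarrow> ('v + 's \<Rightarrow> real) lie_alg" where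
  "graph_lie_algebra G S c =
     \<lparr>carrier = {f. \<forall>x. x \<notin> graph_basis G S \<longrightarrow> f x = 0},
      mult = undefined,
      one = undefined,
      zero = (\<lambda>x. 0),
      add = (\<lambda>f g x. f x + g x),
      smult = (\<lambda>r f x. r * f x),
      lie_bracket = (\<lambda>f g x. \<Sum>a\<in>graph_basis G S. \<Sum>b\<in>graph_basis G S.
                                f a * g b * basis_bracket G c a b x)\<rparr>"


section \<open>Well-definedness\<close>

lemma class_ring_real_field: "field (class_ring :: real ring)"
  by (rule class_field.field_axioms)

lemma basis_bracket_Inl [simp]: "basis_bracket G c a b (Inl v) = 0"
  by (cases "(G, c, a, b)" rule: basis_bracket.cases) (auto simp: basis_vec_def)

lemma basis_bracket_Inr_right [simp]: "basis_bracket G c a (Inr s) x = 0"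
  by (cases a) simp_all

context oriented_graph
begin

lemma basis_bracket_antisym: "basis_bracket G c a b x = - basis_bracket G c b a x"
  by (cases a; cases b) (auto dest: no_antiparallel)

lemma basis_bracket_support:
  assumes "c ` parcs G = S" "x \<notin> graph_basis G S"
  shows "basis_bracket G c a b x = 0"
  proof -
  have "basis_vec (Inr (c e)) x = 0" if "e \<in> parcs G" for e
    using that assms by (auto simp: graph_basis_def basis_vec_def)
  then show ?thesis
    by (cases a; cases b) simp_all
qed

lemma finite_graph_basis:
  assumes "c ` parcs G = S" shows "finite (graph_basis G S)"
  using assms pair_finite_verts pair_finite_arcs by (auto simp: graph_basis_def)

theorem graph_lie_algebra_is_lie_algebra:
  assumes "c ` parcs G = S"
  shows "lie_algebra (graph_lie_algebra G S c)" (is "lie_algebra ?L")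
proof -
  let ?B = "graph_basis G S"
  have "abelian_group ?L"
  proof (rule abelian_groupI)
    fix x assume "x \<in> carrier ?L"
    then show "\<exists>y\<in>carrier ?L. y \<oplus>\<^bsub>?L\<^esub> x = \<zero>\<^bsub>?L\<^esub>"
      by (intro bexI[of _ "\<lambda>t. - x t"]) (auto simp: graph_lie_algebra_def)
  qed (auto simp: graph_lie_algebra_def)
  then have "Module.module class_ring ?L"
    by (intro Module.moduleI class_cring.cring_axioms)
       (auto simp: graph_lie_algebra_def algebra_simps)
  then interpret vectorspace class_ring ?L
    by (intro vectorspace.intro class_ring_real_field)
  have Inl: "lie_bracket ?L f g (Inl v) = 0" for f g v
    by (simp add: graph_lie_algebra_def)
  have nil: "lie_bracket ?L f (lie_bracket ?L g h) = (\<lambda>x. 0)" for f g h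
  proof
    fix x
    have "f a * lie_bracket ?L g h b * basis_bracket G c a b x = 0" for a b
      by (cases b) (simp_all add: Inl)
    then show "lie_bracket ?L f (lie_bracket ?L g h) x = 0"
      by (subst graph_lie_algebra_def) simp
  qed
  have alt: "lie_bracket ?L f f = (\<lambda>x. 0)" for f
  proof
    fix x
    have "lie_bracket ?L f f x = (\<Sum>a\<in>?B. \<Sum>b\<in>?B. f b * f a * basis_bracket G c b a x)"
      by (simp add: graph_lie_algebra_def) (rule sum.swap)
    also have "\<dots> = (\<Sum>a\<in>?B. \<Sum>b\<in>?B. - (f a * f b * basis_bracket G c a b x))"
      by (intro sum.cong refl) (subst basis_bracket_antisym, simp)
    also have "\<dots> = - lie_bracket ?L f f x"
      by (simp add: graph_lie_algebra_def sum_negf)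
    finally show "lie_bracket ?L f f x = 0" by simp
  qed
  show ?thesis
  proof
    fix f g h assume "f \<in> carrier ?L" "g \<in> carrier ?L" "h \<in> carrier ?L"
    show "lie_bracket ?L f (lie_bracket ?L g h) \<oplus>\<^bsub>?L\<^esub> lie_bracket ?L g (lie_bracket ?L h f)
          \<oplus>\<^bsub>?L\<^esub> lie_bracket ?L h (lie_bracket ?L f g) = \<zero>\<^bsub>?L\<^esub>"
      unfolding nil by (simp add: graph_lie_algebra_def)
  next
    fix f assume "f \<in> carrier ?L"
    show "lie_bracket ?L f f = \<zero>\<^bsub>?L\<^esub>"
      unfolding alt by (simp add: graph_lie_algebra_def)
  next
    fix f g assume "f \<in> carrier ?L" "g \<in> carrier ?L"
    show "lie_bracket ?L f g \<in> carrier ?L"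
      by (auto simp: graph_lie_algebra_def basis_bracket_support[OF assms])
  qed (auto simp: graph_lie_algebra_def sum.distrib sum_distrib_left algebra_simps)
qed

lemma lie_bracket_basis_vec:
  assumes "c ` parcs G = S" "a \<in> graph_basis G S" "b \<in> graph_basis G S"
  shows "lie_bracket (graph_lie_algebra G S c) (basis_vec a) (basis_vec b) = basis_bracket G c a b"
proof
  fix x
  have "(\<Sum>a'\<in>graph_basis G S. \<Sum>b'\<in>graph_basis G S.
           basis_vec a a' * basis_vec b b' * basis_bracket G c a' b' x) =
        (\<Sum>a'\<in>graph_basis G S. \<Sum>b'\<in>graph_basis G S.
           if b' = b then if a' = a then basis_bracket G c a' b' x else 0 else 0)"
    by (intro sum.cong refl) (simp add: basis_vec_def)
  then show "lie_bracket (graph_lie_algebra G S c) (basis_vec a) (basis_vec b) x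
      = basis_bracket G c a b x"
    using assms(2,3) finite_graph_basis[OF assms(1)]
    by (simp add: graph_lie_algebra_def)
qed

end

lemma lie_direct_sum_is_lie_algebra:
  assumes "lie_algebra L" "lie_algebra M"
  shows "lie_algebra (lie_direct_sum L M)"
proof -
  interpret L: lie_algebra L by fact
  interpret M: lie_algebra M by fact
  let ?D = "lie_direct_sum L M"
  note D = lie_direct_sum_def direct_sum_def module.defs
  interpret D: vectorspace class_ring "direct_sum L M"
    by (intro direct_sum_is_vs L.vectorspace_axioms M.vectorspace_axioms)
  have "abelian_group ?D"
  proof (rule abelian_groupI)
    fix x assume "x \<in> carrier ?D"
    then show "\<exists>y\<in>carrier ?D. y \<oplus>\<^bsub>?D\<^esub> x = \<zero>\<^bsub>?D\<^esub>"
      by (intro bexI[of _ "(\<ominus>\<^bsub>L\<^esub> fst x, \<ominus>\<^bsub>M\<^esub> snd x)"]) (auto simp: D L.l_neg M.l_neg)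
  qed (auto simp: D L.a_ac M.a_ac)
  then have "Module.module class_ring ?D"
    by (intro Module.moduleI class_cring.cring_axioms)
       (use D.smult_l_distr D.smult_r_distr D.smult_assoc1 L.smult_one M.smult_one in \<open>auto simp: D\<close>)
  then interpret vectorspace class_ring ?D
    by (intro vectorspace.intro class_ring_real_field)
  show ?thesis
    by unfold_locales
       (auto simp: D L.bracket_closed M.bracket_closed
          L.bracket_add_left M.bracket_add_left L.bracket_add_right M.bracket_add_right
          L.bracket_smult_left M.bracket_smult_left L.bracket_smult_right M.bracket_smult_right
          L.bracket_self M.bracket_self L.jacobi M.jacobi)
qed

lemma lie_ideal_abelian_subgroup:
  assumes "lie_algebra L" "lie_ideal I L"
  shows "abelian_subgroup I L"
proof -
  interpret L: lie_algebra L by fact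
  have I: "LinearCombinations.submodule class_ring I L"
    using assms(2) by (simp add: lie_ideal_def VectorSpace.subspace_def)
  have "\<ominus>\<^bsub>L\<^esub> x \<in> I" if "x \<in> I" for x
  proof -
    have "x \<in> carrier L" using I that by (auto dest: submodule.subset)
    then have "\<ominus>\<^bsub>L\<^esub> x = (\<ominus>\<^bsub>class_ring\<^esub> \<one>\<^bsub>class_ring\<^esub>) \<odot>\<^bsub>L\<^esub> x"
      using L.smult_l_minus[of "\<one>\<^bsub>class_ring\<^esub>" x] L.smult_one[of x] by simp
    with submodule.smult_closed[OF I _ that] show ?thesis by simp
  qed
  then have "subgroup I (add_monoid L)"
    using I by unfold_locales
      (auto simp: LinearCombinations.submodule_def a_inv_def)
  then show ?thesis
    by (intro abelian_subgroupI3 additive_subgroup.intro L.abelian_group_axioms)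
qed

lemma lie_quotient_ops:
  assumes "lie_algebra L" "lie_ideal I L" "x \<in> carrier L" "y \<in> carrier L"
  shows "a_r_coset L I x \<oplus>\<^bsub>lie_quotient L I\<^esub> a_r_coset L I y = a_r_coset L I (x \<oplus>\<^bsub>L\<^esub> y)"
    and "a \<odot>\<^bsub>lie_quotient L I\<^esub> a_r_coset L I x = a_r_coset L I (a \<odot>\<^bsub>L\<^esub> x)"
    and "lie_bracket (lie_quotient L I) (a_r_coset L I x) (a_r_coset L I y)
           = a_r_coset L I (lie_bracket L x y)"
proof -
  interpret L: lie_algebra L by fact
  interpret I: abelian_subgroup I L by (rule lie_ideal_abelian_subgroup[OF assms(1,2)])
  have smult_I: "r \<odot>\<^bsub>L\<^esub> u \<in> I" if "u \<in> I" for r u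
    using assms(2) that
    by (auto simp: lie_ideal_def VectorSpace.subspace_def LinearCombinations.submodule_def)
  have br_I: "lie_bracket L u v \<in> I" if "u \<in> carrier L" "v \<in> I" for u v
    using assms(2) that by (auto simp: lie_ideal_def)
  have br_I': "lie_bracket L v u \<in> I" if u: "u \<in> carrier L" and v: "v \<in> I" for u v
  proof -
    have vc: "v \<in> carrier L" using v by (rule I.a_Hcarr)
    have "lie_bracket L (u \<oplus>\<^bsub>L\<^esub> v) (u \<oplus>\<^bsub>L\<^esub> v) =
        (lie_bracket L u u \<oplus>\<^bsub>L\<^esub> lie_bracket L v u) \<oplus>\<^bsub>L\<^esub>
        (lie_bracket L u v \<oplus>\<^bsub>L\<^esub> lie_bracket L v v)"
      using u vc by (simp only: L.bracket_add_left L.bracket_add_right L.a_closed)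
    then have "lie_bracket L v u \<oplus>\<^bsub>L\<^esub> lie_bracket L u v = \<zero>\<^bsub>L\<^esub>"
      using u vc by (simp add: L.bracket_self L.bracket_closed)
    then have "lie_bracket L v u = \<ominus>\<^bsub>L\<^esub> lie_bracket L u v"
      using u vc by (simp add: L.minus_equality L.bracket_closed)
    then show ?thesis using br_I[OF u v] by simp
  qed
  have coset: "a_r_coset L I u = {h \<oplus>\<^bsub>L\<^esub> u | h. h \<in> I}" for u
    by (auto simp: a_r_coset_def r_coset_def)
  have eq: "a_r_coset L I (h \<oplus>\<^bsub>L\<^esub> u) = a_r_coset L I u" if "h \<in> I" "u \<in> carrier L" for h u
    using I.a_repr_independence'[of "h \<oplus>\<^bsub>L\<^esub> u" u] that by (auto simp: coset)
  have ne: "a_r_coset L I u \<noteq> {}" for u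
    using I.a_subgroup subgroup.one_closed by (fastforce simp: coset)
  show "a_r_coset L I x \<oplus>\<^bsub>lie_quotient L I\<^esub> a_r_coset L I y = a_r_coset L I (x \<oplus>\<^bsub>L\<^esub> y)"
    using assms(3,4) by (simp add: lie_quotient_def ring.defs FactRing_def I.a_rcos_sum)
  have "a_r_coset L I (a \<odot>\<^bsub>L\<^esub> x') = a_r_coset L I (a \<odot>\<^bsub>L\<^esub> x)" if "x' \<in> a_r_coset L I x" for x'
    using that assms(3) by (auto simp: coset[of x] L.smult_r_distr I.a_Hcarr eq smult_I)
  with ne[of x] show "a \<odot>\<^bsub>lie_quotient L I\<^esub> a_r_coset L I x = a_r_coset L I (a \<odot>\<^bsub>L\<^esub> x)"
    by (simp add: lie_quotient_def ring.defs)
  have "a_r_coset L I (lie_bracket L x' y') = a_r_coset L I (lie_bracket L x y)"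
    if x': "x' \<in> a_r_coset L I x" and y': "y' \<in> a_r_coset L I y" for x' y'
  proof -
    obtain h where h: "h \<in> I" "x' = h \<oplus>\<^bsub>L\<^esub> x" using x' by (auto simp: coset)
    obtain k where k: "k \<in> I" "y' = k \<oplus>\<^bsub>L\<^esub> y" using y' by (auto simp: coset)
    have hk: "h \<in> carrier L" "k \<in> carrier L" "y' \<in> carrier L"
      using h k assms(4) by (auto simp: I.a_Hcarr)
    have "lie_bracket L x' y'
        = lie_bracket L h y' \<oplus>\<^bsub>L\<^esub> (lie_bracket L x k \<oplus>\<^bsub>L\<^esub> lie_bracket L x y)"
    proof -
      have "lie_bracket L x' y' = lie_bracket L h y' \<oplus>\<^bsub>L\<^esub> lie_bracket L x y'"
        using hk assms(3) h(2) by (simp add: L.bracket_add_left)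
      also have "lie_bracket L x y' = lie_bracket L x k \<oplus>\<^bsub>L\<^esub> lie_bracket L x y"
        using hk assms(3,4) k(2) by (simp add: L.bracket_add_right)
      finally show ?thesis .
    qed
    then show ?thesis
      using br_I'[OF hk(3) h(1)] br_I[OF assms(3) k(1)] hk assms(3,4)
      by (simp add: eq L.bracket_closed)
  qed
  with ne[of x] ne[of y]
  show "lie_bracket (lie_quotient L I) (a_r_coset L I x) (a_r_coset L I y)
      = a_r_coset L I (lie_bracket L x y)"
    by (simp add: lie_quotient_def ring.defs)
qed

lemma lie_quotient_is_lie_algebra:
  assumes "lie_algebra L" "lie_ideal I L"
  shows "lie_algebra (lie_quotient L I)"
proof -
  let ?Q = "lie_quotient L I"
  interpret L: lie_algebra L by fact
  interpret I: abelian_subgroup I L by (rule lie_ideal_abelian_subgroup[OF assms])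
  note ops = lie_quotient_ops[OF assms]
  have carrier: "carrier ?Q = a_r_coset L I ` carrier L"
    by (auto simp: lie_quotient_def ring.defs FactRing_def A_RCOSETS_def RCOSETS_def a_r_coset_def)
  have zero: "\<zero>\<^bsub>?Q\<^esub> = a_r_coset L I \<zero>\<^bsub>L\<^esub>"
    using I.a_Hcarr by (auto simp: lie_quotient_def ring.defs FactRing_def a_r_coset_def r_coset_def)
  have "abelian_group ?Q"
  proof (rule abelian_groupI)
    fix X assume "X \<in> carrier ?Q"
    then obtain x where "x \<in> carrier L" "X = a_r_coset L I x" by (auto simp: carrier)
    then show "\<exists>Y\<in>carrier ?Q. Y \<oplus>\<^bsub>?Q\<^esub> X = \<zero>\<^bsub>?Q\<^esub>"
      by (intro bexI[of _ "a_r_coset L I (\<ominus>\<^bsub>L\<^esub> x)"]) (auto simp: carrier ops zero L.l_neg)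
  qed (auto simp: carrier ops zero L.a_ac)
  then have "Module.module class_ring ?Q"
    by (intro Module.moduleI class_cring.cring_axioms)
       (use L.smult_l_distr L.smult_r_distr L.smult_assoc1 L.smult_one in \<open>auto simp: carrier ops\<close>)
  then interpret vectorspace class_ring ?Q
    by (intro vectorspace.intro class_ring_real_field)
  show ?thesis
    by unfold_locales
       (auto simp: carrier ops zero L.bracket_closed L.bracket_add_left L.bracket_add_right
          L.bracket_smult_left L.bracket_smult_right L.bracket_self L.jacobi)
qed

end

theory Submission
  imports Defs
begin

text \<open>
  Both \<open>n\<^sub>1\<close> and \<open>n\<^sub>2\<close> consist of functions on the same tagged union of vertices and colors, and
  pointwise addition \<open>(f, g) \<mapsto> f + g\<close> is a surjective Lie homomorphism from \<open>n\<^sub>1 \<oplus> n\<^sub>2\<close> onto \<open>n\<close>: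
  no edge joins the two vertex sets, so mixed brackets vanish in \<open>n\<close>. As the vertex sets are
  disjoint, its kernel is the set of pairs \<open>(f, -f)\<close> with \<open>f\<close> supported on common colors, which is
  \<open>i\<close>. The claim is the first isomorphism theorem.
\<close>

section \<open>Homomorphisms of Lie algebras\<close>

text \<open>\<open>lie_iso\<close> without bijectivity, because the addition map is in general not
  injective.\<close>

definition lie_hom :: "'a lie_alg \<Rightarrow> 'b lie_alg \<Rightarrow> ('a \<Rightarrow> 'b) set" where
  "lie_hom L M = {h. h \<in> LinearCombinations.module_hom class_ring L M \<and>
     (\<forall>x\<in>carrier L. \<forall>y\<in>carrier L. h (lie_bracket L x y) = lie_bracket M (h x) (h y))}"

definition lie_kernel :: "'a lie_alg \<Rightarrow> 'b lie_alg \<Rightarrow> ('a \<Rightarrow> 'b) \<Rightarrow> 'a set" where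
  "lie_kernel L M h = {x \<in> carrier L. h x = \<zero>\<^bsub>M\<^esub>}"

lemma lie_iso_iff: "h \<in> lie_iso L M \<longleftrightarrow> h \<in> lie_hom L M \<and> bij_betw h (carrier L) (carrier M)"
  by (auto simp: lie_iso_def lie_hom_def)

lemma lie_homD:
  assumes "h \<in> lie_hom L M" "x \<in> carrier L"
  shows "h x \<in> carrier M"
    and "h (a \<odot>\<^bsub>L\<^esub> x) = a \<odot>\<^bsub>M\<^esub> h x"
    and "y \<in> carrier L \<Longrightarrow> h (x \<oplus>\<^bsub>L\<^esub> y) = h x \<oplus>\<^bsub>M\<^esub> h y"
    and "y \<in> carrier L \<Longrightarrow> h (lie_bracket L x y) = lie_bracket M (h x) (h y)"
  using assms by (auto simp: lie_hom_def LinearCombinations.module_hom_def)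

lemma lie_homI:
  assumes "\<And>x. x \<in> carrier L \<Longrightarrow> h x \<in> carrier M"
    and "\<And>a x. x \<in> carrier L \<Longrightarrow> h (a \<odot>\<^bsub>L\<^esub> x) = a \<odot>\<^bsub>M\<^esub> h x"
    and "\<And>x y. x \<in> carrier L \<Longrightarrow> y \<in> carrier L \<Longrightarrow> h (x \<oplus>\<^bsub>L\<^esub> y) = h x \<oplus>\<^bsub>M\<^esub> h y"
    and "\<And>x y. x \<in> carrier L \<Longrightarrow> y \<in> carrier L \<Longrightarrow>
      h (lie_bracket L x y) = lie_bracket M (h x) (h y)"
  shows "h \<in> lie_hom L M"
  using assms by (auto simp: lie_hom_def LinearCombinations.module_hom_def)

section \<open>Kernels and the isomorphisms they induce\<close>

lemma lie_hom_zero: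
  assumes "lie_algebra L" "lie_algebra M" "h \<in> lie_hom L M"
  shows "h \<zero>\<^bsub>L\<^esub> = \<zero>\<^bsub>M\<^esub>"
proof -
  interpret L: lie_algebra L by fact
  interpret M: lie_algebra M by fact
  \<comment> \<open>Homogeneity at the scalar \<open>0\<close> yields preservation of zero.\<close>
  have "h (0 \<odot>\<^bsub>L\<^esub> \<zero>\<^bsub>L\<^esub>) = 0 \<odot>\<^bsub>M\<^esub> h \<zero>\<^bsub>L\<^esub>"
    by (rule lie_homD(2)[OF assms(3)]) simp
  then show ?thesis
    using L.lmult_0[of "\<zero>\<^bsub>L\<^esub>"] M.lmult_0[OF lie_homD(1)[OF assms(3) L.zero_closed]] by simp
qed

lemma lie_hom_minus:
  assumes "lie_algebra L" "lie_algebra M" "h \<in> lie_hom L M" "x \<in> carrier L"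
  shows "h (\<ominus>\<^bsub>L\<^esub> x) = \<ominus>\<^bsub>M\<^esub> h x"
proof -
  interpret L: lie_algebra L by fact
  interpret M: lie_algebra M by fact
  note hom = lie_homD[OF assms(3)]
  have "h (\<ominus>\<^bsub>L\<^esub> x) \<oplus>\<^bsub>M\<^esub> h x = \<zero>\<^bsub>M\<^esub>"
    using assms(4) lie_hom_zero[OF assms(1-3)]
    by (simp add: hom(3)[symmetric] L.l_neg)
  then show ?thesis
    using assms(4) by (metis M.minus_equality hom(1) L.a_inv_closed)
qed

lemma lie_kernel_submodule:
  assumes "lie_algebra L" "lie_algebra M" "h \<in> lie_hom L M"
  shows "LinearCombinations.submodule class_ring (lie_kernel L M h) L"
proof -
  interpret L: lie_algebra L by fact
  interpret M: lie_algebra M by fact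
  show ?thesis
    using lie_hom_zero[OF assms] lie_homD[OF assms(3)] L.smult_closed
    by unfold_locales (auto simp: lie_kernel_def)
qed

lemma lie_kernel_ideal:
  assumes "lie_algebra L" "lie_algebra M" "h \<in> lie_hom L M"
  shows "lie_ideal (lie_kernel L M h) L"
proof -
  interpret L: lie_algebra L by fact
  interpret M: lie_algebra M by fact
  \<comment> \<open>A bracket with zero vanishes: write zero as \<open>0\<close> times itself and
    pull the scalar out of the second argument.\<close>
  have "lie_bracket M y \<zero>\<^bsub>M\<^esub> = \<zero>\<^bsub>M\<^esub>" if "y \<in> carrier M" for y
    using M.bracket_smult_right[of y "\<zero>\<^bsub>M\<^esub>" 0] that M.bracket_closed[of y "\<zero>\<^bsub>M\<^esub>"] M.lmult_0
    by simp
  then show ?thesis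
    using lie_kernel_submodule[OF assms] lie_homD[OF assms(3)] L.bracket_closed
    by (auto simp: lie_ideal_def VectorSpace.subspace_def lie_kernel_def L.vectorspace_axioms)
qed

text \<open>The first isomorphism theorem, proved from \<open>M\<close> to the quotient: each point
  goes to its fibre under \<open>h\<close>, and the fibres are exactly the cosets of the kernel. In
  this direction no map has to be shown well defined on cosets.\<close>

lemma lie_isomorphic_quotient_kernel:
  assumes "lie_algebra L" "lie_algebra M" "h \<in> lie_hom L M" "h ` carrier L = carrier M"
  shows "lie_isomorphic M (lie_quotient L (lie_kernel L M h))"
proof -
  interpret L: lie_algebra L by fact
  interpret M: lie_algebra M by fact
  let ?K = "lie_kernel L M h"
  let ?Q = "lie_quotient L ?K"
  note hom = lie_homD[OF assms(3)]
  note ideal = lie_kernel_ideal[OF assms(1-3)]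
  note ops = lie_quotient_ops[OF assms(1) ideal]
  \<comment> \<open>The fibre over \<open>y\<close>, described without choosing a preimage.\<close>
  define F where "F y = {x \<in> carrier L. h x = y}" for y
  have F: "F (h x) = a_r_coset L ?K x" if x: "x \<in> carrier L" for x
  proof (intro equalityI subsetI)
    fix y assume "y \<in> F (h x)"
    then have y: "y \<in> carrier L" "h y = h x" by (auto simp: F_def)
    then have "y \<oplus>\<^bsub>L\<^esub> \<ominus>\<^bsub>L\<^esub> x \<in> ?K"
      using x by (simp add: lie_kernel_def hom lie_hom_minus[OF assms(1-3)] M.r_neg)
    moreover have "y = (y \<oplus>\<^bsub>L\<^esub> \<ominus>\<^bsub>L\<^esub> x) \<oplus>\<^bsub>L\<^esub> x"
      using x y by (simp add: L.a_assoc L.l_neg)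
    ultimately show "y \<in> a_r_coset L ?K x"
      by (auto simp: a_r_coset_def r_coset_def)
  next
    fix y assume "y \<in> a_r_coset L ?K x"
    then show "y \<in> F (h x)"
      using x by (auto simp: a_r_coset_def r_coset_def F_def lie_kernel_def hom)
  qed
  have carrier: "carrier ?Q = F ` carrier M"
  proof -
    have "carrier ?Q = a_r_coset L ?K ` carrier L"
      by (auto simp: lie_quotient_def ring.defs FactRing_def A_RCOSETS_def RCOSETS_def a_r_coset_def)
    also have "\<dots> = F ` h ` carrier L"
      by (simp add: image_image F)
    finally show ?thesis by (simp only: assms(4))
  qed
  have lift: "\<exists>x\<in>carrier L. y = h x" if "y \<in> carrier M" for y
    using that assms(4) by auto
  have "F \<in> lie_hom M ?Q"
  proof (rule lie_homI)
    show "F y \<in> carrier ?Q" if "y \<in> carrier M" for y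
      using that by (simp add: carrier)
    show "F (a \<odot>\<^bsub>M\<^esub> y) = a \<odot>\<^bsub>?Q\<^esub> F y" if "y \<in> carrier M" for a y
      using lift[OF that] ops(2) L.smult_closed by (auto simp: F hom(2)[symmetric])
    show "F (y \<oplus>\<^bsub>M\<^esub> z) = F y \<oplus>\<^bsub>?Q\<^esub> F z" if "y \<in> carrier M" "z \<in> carrier M" for y z
      using lift[OF that(1)] lift[OF that(2)] ops(1) by (auto simp: F hom(3)[symmetric])
    show "F (lie_bracket M y z) = lie_bracket ?Q (F y) (F z)"
      if "y \<in> carrier M" "z \<in> carrier M" for y z
      using lift[OF that(1)] lift[OF that(2)] ops(3) L.bracket_closed
      by (auto simp: F hom(4)[symmetric])
  qed
  moreover have "inj_on F (carrier M)"
    \<comment> \<open>By surjectivity every fibre over \<open>carrier M\<close> is nonempty, and any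
      element of a fibre determines its base point.\<close>
    by (rule inj_onI) (use lift in \<open>force simp: F_def\<close>)
  ultimately have "F \<in> lie_iso M ?Q"
    by (simp add: lie_iso_iff bij_betw_def carrier)
  then show ?thesis by (auto simp: lie_isomorphic_def)
qed

text \<open>Every element of \<open>M\<close> is some \<open>h x\<close>, so the laws for the
  inverse are those of \<open>h\<close> read backwards; closure of \<open>L\<close> under its
  operations keeps the arguments where the inverse cancels \<open>h\<close>.\<close>

lemma lie_isomorphic_sym:
  assumes "lie_algebra L" "lie_isomorphic L M"
  shows "lie_isomorphic M L"
proof -
  interpret L: lie_algebra L by fact
  obtain h where h: "h \<in> lie_hom L M" "bij_betw h (carrier L) (carrier M)"
    using assms(2) by (auto simp: lie_isomorphic_def lie_iso_iff)
  note hom = lie_homD[OF h(1)]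
  define g where "g = inv_into (carrier L) h"
  have g: "g (h x) = x" if "x \<in> carrier L" for x
    using h(2) that by (simp add: g_def bij_betw_inv_into_left)
  have lift: "\<exists>x\<in>carrier L. y = h x" if "y \<in> carrier M" for y
    using that h(2) by (auto simp: bij_betw_def)
  have "g \<in> lie_hom M L"
  proof (rule lie_homI)
    show "g y \<in> carrier L" if "y \<in> carrier M" for y
      using lift[OF that] g by auto
    show "g (a \<odot>\<^bsub>M\<^esub> y) = a \<odot>\<^bsub>L\<^esub> g y" if "y \<in> carrier M" for a y
      using lift[OF that] L.smult_closed by (auto simp: g hom(2)[symmetric])
    show "g (y \<oplus>\<^bsub>M\<^esub> z) = g y \<oplus>\<^bsub>L\<^esub> g z" if "y \<in> carrier M" "z \<in> carrier M" for y z
      using lift[OF that(1)] lift[OF that(2)] by (auto simp: g hom(3)[symmetric])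
    show "g (lie_bracket M y z) = lie_bracket L (g y) (g z)"
      if "y \<in> carrier M" "z \<in> carrier M" for y z
      using lift[OF that(1)] lift[OF that(2)] L.bracket_closed by (auto simp: g hom(4)[symmetric])
  qed
  moreover have "bij_betw g (carrier M) (carrier L)"
    using h(2) by (simp add: g_def bij_betw_inv_into)
  ultimately show ?thesis by (auto simp: lie_isomorphic_def lie_iso_iff)
qed

lemma lie_hom_inj_on:
  assumes "lie_algebra L" "lie_algebra M" "h \<in> lie_hom L M" "lie_kernel L M h = {\<zero>\<^bsub>L\<^esub>}"
  shows "inj_on h (carrier L)"
proof (rule inj_onI)
  interpret L: lie_algebra L by fact
  interpret M: lie_algebra M by fact
  note hom = lie_homD[OF assms(3)]
  fix x y assume xy: "x \<in> carrier L" "y \<in> carrier L" "h x = h y"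
  then have "x \<oplus>\<^bsub>L\<^esub> \<ominus>\<^bsub>L\<^esub> y \<in> lie_kernel L M h"
    by (simp add: lie_kernel_def hom lie_hom_minus[OF assms(1-3)] M.r_neg)
  then have "x \<oplus>\<^bsub>L\<^esub> \<ominus>\<^bsub>L\<^esub> y = \<zero>\<^bsub>L\<^esub>" using assms(4) by simp
  then show "x = y"
    using xy by (metis L.minus_equality L.minus_minus L.a_inv_closed)
qed

section \<open>Sums of colored graphs\<close>

lemma graph_lie_algebra_simps:
  "f \<in> carrier (graph_lie_algebra G S c) \<longleftrightarrow> (\<forall>x. x \<notin> graph_basis G S \<longrightarrow> f x = 0)"
  "\<zero>\<^bsub>graph_lie_algebra G S c\<^esub> = (\<lambda>x. 0)"
  "f \<oplus>\<^bsub>graph_lie_algebra G S c\<^esub> g = (\<lambda>x. f x + g x)"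
  "r \<odot>\<^bsub>graph_lie_algebra G S c\<^esub> f = (\<lambda>x. r * f x)"
  by (simp_all add: graph_lie_algebra_def)

text \<open>The generators of the ideal use the abstract additive inverse; uniqueness of inverses
  identifies it with pointwise negation.\<close>

lemma graph_lie_algebra_minus:
  assumes "lie_algebra (graph_lie_algebra G S c)" "f \<in> carrier (graph_lie_algebra G S c)"
  shows "\<ominus>\<^bsub>graph_lie_algebra G S c\<^esub> f = (\<lambda>x. - f x)"
proof -
  interpret lie_algebra "graph_lie_algebra G S c" by fact
  show ?thesis
    by (rule minus_equality) (use assms(2) in \<open>auto simp: graph_lie_algebra_simps\<close>)
qed

text \<open>Only the vertex sets are disjoint here. Colors may be shared, and the shared ones
  produce the kernel.\<close>

locale disjoint_colored_graphs = G1: oriented_graph G1 + G2: oriented_graph G2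
  for G1 G2 :: "'v pair_pre_digraph" +
  fixes c1 c2 :: "'v \<times> 'v \<Rightarrow> 's" and S1 S2 :: "'s set"
  assumes c1: "c1 ` parcs G1 = S1" and c2: "c2 ` parcs G2 = S2"
    and disjoint: "pverts G1 \<inter> pverts G2 = {}"
begin

abbreviation "N1 \<equiv> graph_lie_algebra G1 S1 c1"
abbreviation "N2 \<equiv> graph_lie_algebra G2 S2 c2"
abbreviation "N \<equiv> graph_lie_algebra (graph_sum G1 G2) (S1 \<union> S2) (sum_coloring G1 c1 c2)"
abbreviation "B1 \<equiv> graph_basis G1 S1"
abbreviation "B2 \<equiv> graph_basis G2 S2"
abbreviation "B \<equiv> graph_basis (graph_sum G1 G2) (S1 \<union> S2)"

definition add_map :: "('v + 's \<Rightarrow> real) \<times> ('v + 's \<Rightarrow> real) \<Rightarrow> 'v + 's \<Rightarrow> real" where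
  "add_map p = (\<lambda>x. fst p x + snd p x)"

section \<open>Arcs and colors of the sum graph\<close>

lemma arcs1: "(v, w) \<in> parcs G1 \<Longrightarrow> v \<in> pverts G1 \<and> w \<in> pverts G1"
  using G1.in_arcsD1 G1.in_arcsD2 by blast

lemma arcs2: "(v, w) \<in> parcs G2 \<Longrightarrow> v \<in> pverts G2 \<and> w \<in> pverts G2"
  using G2.in_arcsD1 G2.in_arcsD2 by blast

text \<open>An arc of one graph whose reverse lies in the other would have its endpoints in both
  vertex sets; reversal within one graph is excluded by that graph's own orientation.\<close>

lemma oriented_graph_sum: "oriented_graph (graph_sum G1 G2)"
proof
  show "finite (pverts (graph_sum G1 G2))" "finite (parcs (graph_sum G1 G2))"
    by (auto simp: graph_sum_def)
  show "fst e \<in> pverts (graph_sum G1 G2)" "snd e \<in> pverts (graph_sum G1 G2)"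
      "fst e \<noteq> snd e" if "e \<in> parcs (graph_sum G1 G2)" for e
    using that arcs1 arcs2 G1.no_loops G2.no_loops by (cases e; auto simp: graph_sum_def)+
  show "(w, v) \<notin> parcs (graph_sum G1 G2)" if "(v, w) \<in> parcs (graph_sum G1 G2)" for v w
    using that arcs1[of v w] arcs1[of w v] arcs2[of v w] arcs2[of w v]
      G1.no_antiparallel[of v w] G2.no_antiparallel[of v w] disjoint
    by (auto simp: graph_sum_def)
qed

text \<open>A common arc would have its endpoints in both vertex sets. Hence
  \<open>sum_coloring\<close>, which tries \<open>c1\<close> first, agrees with \<open>c2\<close> on
  all arcs of \<open>G2\<close>.\<close>

lemma parcs_disjoint: "parcs G1 \<inter> parcs G2 = {}"
  using arcs1 arcs2 disjoint by fastforce

lemma sum_coloring_image: "sum_coloring G1 c1 c2 ` parcs (graph_sum G1 G2) = S1 \<union> S2"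
proof -
  have "sum_coloring G1 c1 c2 ` parcs G1 = S1"
    unfolding c1[symmetric] by (rule image_cong) (auto simp: sum_coloring_def)
  moreover have "sum_coloring G1 c1 c2 ` parcs G2 = S2"
    unfolding c2[symmetric]
    by (rule image_cong) (use parcs_disjoint in \<open>auto simp: sum_coloring_def\<close>)
  ultimately show ?thesis by (simp add: graph_sum_def image_Un)
qed

lemma lie_algebra_n1: "lie_algebra N1"
  by (rule G1.graph_lie_algebra_is_lie_algebra[OF c1])

lemma lie_algebra_n2: "lie_algebra N2"
  by (rule G2.graph_lie_algebra_is_lie_algebra[OF c2])

lemma lie_algebra_n: "lie_algebra N"
  by (rule oriented_graph.graph_lie_algebra_is_lie_algebra[OF oriented_graph_sum sum_coloring_image])

lemma lie_algebra_direct_sum: "lie_algebra (lie_direct_sum N1 N2)"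
  by (rule lie_direct_sum_is_lie_algebra[OF lie_algebra_n1 lie_algebra_n2])

section \<open>Bases and brackets of the sum graph\<close>

lemma basis_Un: "B = B1 \<union> B2"
  by (auto simp: graph_basis_def graph_sum_def)

text \<open>Vertices carry the tag \<open>Inl\<close> and colors the tag \<open>Inr\<close>, so with
  disjoint vertex sets only shared colors can lie in both bases.\<close>

lemma basis_Int: "B1 \<inter> B2 = Inr ` (S1 \<inter> S2)"
  using disjoint by (auto simp: graph_basis_def)

lemma finite_basis: "finite B1" "finite B2" "finite B"
  using G1.finite_graph_basis[OF c1] G2.finite_graph_basis[OF c2] by (simp_all add: basis_Un)

text \<open>Arcs of the sum between vertices of one graph belong to that graph, and no arc joins the
  two graphs. The cases overlap at shared colors, consistently, since every bracket with a color is
  zero.\<close>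

lemma basis_bracket_sum:
  "a \<in> B1 \<Longrightarrow> b \<in> B1 \<Longrightarrow>
    basis_bracket (graph_sum G1 G2) (sum_coloring G1 c1 c2) a b = basis_bracket G1 c1 a b"
  "a \<in> B2 \<Longrightarrow> b \<in> B2 \<Longrightarrow>
    basis_bracket (graph_sum G1 G2) (sum_coloring G1 c1 c2) a b = basis_bracket G2 c2 a b"
  "a \<in> B1 \<Longrightarrow> b \<in> B2 \<Longrightarrow>
    basis_bracket (graph_sum G1 G2) (sum_coloring G1 c1 c2) a b = (\<lambda>x. 0)"
  "a \<in> B2 \<Longrightarrow> b \<in> B1 \<Longrightarrow>
    basis_bracket (graph_sum G1 G2) (sum_coloring G1 c1 c2) a b = (\<lambda>x. 0)"
  using disjoint
  by (cases a; cases b;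
      force simp: graph_basis_def graph_sum_def sum_coloring_def fun_eq_iff dest: arcs1 arcs2)+

text \<open>Terms outside \<open>B'\<close> or \<open>B''\<close> contain a zero factor. Choosing
  each of the two sets as \<open>B1\<close> or \<open>B2\<close> lets
  \<open>basis_bracket_sum\<close> evaluate the remaining terms.\<close>

lemma bracket_restrict:
  assumes "B' \<subseteq> B" "B'' \<subseteq> B" "\<And>x. x \<notin> B' \<Longrightarrow> f x = 0" "\<And>x. x \<notin> B'' \<Longrightarrow> g x = 0"
  shows "lie_bracket N f g x = (\<Sum>a\<in>B'. \<Sum>b\<in>B''.
    f a * g b * basis_bracket (graph_sum G1 G2) (sum_coloring G1 c1 c2) a b x)"
proof -
  let ?b = "basis_bracket (graph_sum G1 G2) (sum_coloring G1 c1 c2)"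
  have "lie_bracket N f g x = (\<Sum>a\<in>B. \<Sum>b\<in>B. f a * g b * ?b a b x)"
    by (simp add: graph_lie_algebra_def)
  also have "\<dots> = (\<Sum>a\<in>B'. \<Sum>b\<in>B. f a * g b * ?b a b x)"
    using assms(1,3) by (intro sum.mono_neutral_right finite_basis) auto
  also have "\<dots> = (\<Sum>a\<in>B'. \<Sum>b\<in>B''. f a * g b * ?b a b x)"
    using assms(2,4) by (intro sum.cong refl sum.mono_neutral_right finite_basis) auto
  finally show ?thesis .
qed

section \<open>The addition map and its kernel\<close>

lemma direct_sum_simps:
  "p \<in> carrier (lie_direct_sum N1 N2) \<longleftrightarrow>
    (\<forall>x. x \<notin> B1 \<longrightarrow> fst p x = 0) \<and> (\<forall>x. x \<notin> B2 \<longrightarrow> snd p x = 0)"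
  "\<zero>\<^bsub>lie_direct_sum N1 N2\<^esub> = (\<lambda>x. 0, \<lambda>x. 0)"
  "p \<oplus>\<^bsub>lie_direct_sum N1 N2\<^esub> q = (\<lambda>x. fst p x + fst q x, \<lambda>x. snd p x + snd q x)"
  "r \<odot>\<^bsub>lie_direct_sum N1 N2\<^esub> p = (\<lambda>x. r * fst p x, \<lambda>x. r * snd p x)"
  "lie_bracket (lie_direct_sum N1 N2) p q =
    (lie_bracket N1 (fst p) (fst q), lie_bracket N2 (snd p) (snd q))"
  by (cases p; cases q; force simp: lie_direct_sum_def direct_sum_def module.defs graph_lie_algebra_def)+

text \<open>For the bracket, \<open>[f + g, f' + g']\<close> is expanded bilinearly in
  \<open>N\<close>: the two mixed brackets vanish, and the other two are the brackets of
  \<open>N1\<close> and \<open>N2\<close>. The linear laws hold pointwise.\<close>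

lemma add_map_hom: "add_map \<in> lie_hom (lie_direct_sum N1 N2) N"
proof (rule lie_homI)
  fix p q assume p: "p \<in> carrier (lie_direct_sum N1 N2)"
    and q: "q \<in> carrier (lie_direct_sum N1 N2)"
  interpret n: lie_algebra N by (rule lie_algebra_n)
  let ?f = "fst p" and ?g = "snd p" and ?f' = "fst q" and ?g' = "snd q"
  have f: "\<And>x. x \<notin> B1 \<Longrightarrow> ?f x = 0" "\<And>x. x \<notin> B1 \<Longrightarrow> ?f' x = 0"
    and g: "\<And>x. x \<notin> B2 \<Longrightarrow> ?g x = 0" "\<And>x. x \<notin> B2 \<Longrightarrow> ?g' x = 0"
    using p q by (auto simp: direct_sum_simps)
  have sub: "B1 \<subseteq> B" "B2 \<subseteq> B" by (auto simp: basis_Un)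
  have carrier: "?f \<in> carrier N" "?g \<in> carrier N" "?f' \<in> carrier N" "?g' \<in> carrier N"
    using f g by (auto simp: graph_lie_algebra_simps basis_Un)
  have add: "u \<oplus>\<^bsub>N\<^esub> v = (\<lambda>x. u x + v x)" for u v
    by (simp add: graph_lie_algebra_simps)
  have "lie_bracket N ?f ?f' = lie_bracket N1 ?f ?f'"
    by (rule ext, subst bracket_restrict[OF sub(1,1) f])
       (simp_all add: graph_lie_algebra_def basis_bracket_sum)
  moreover have "lie_bracket N ?g ?g' = lie_bracket N2 ?g ?g'"
    by (rule ext, subst bracket_restrict[OF sub(2,2) g])
       (simp_all add: graph_lie_algebra_def basis_bracket_sum)
  moreover have "lie_bracket N ?f ?g' = (\<lambda>x. 0)"
    by (rule ext, subst bracket_restrict[OF sub(1,2) f(1) g(2)]) (simp_all add: basis_bracket_sum)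
  moreover have "lie_bracket N ?g ?f' = (\<lambda>x. 0)"
    by (rule ext, subst bracket_restrict[OF sub(2,1) g(1) f(2)]) (simp_all add: basis_bracket_sum)
  moreover have "lie_bracket N (?f \<oplus>\<^bsub>N\<^esub> ?g) (?f' \<oplus>\<^bsub>N\<^esub> ?g') =
      (lie_bracket N ?f ?f' \<oplus>\<^bsub>N\<^esub> lie_bracket N ?g ?f') \<oplus>\<^bsub>N\<^esub>
      (lie_bracket N ?f ?g' \<oplus>\<^bsub>N\<^esub> lie_bracket N ?g ?g')"
    using carrier by (simp only: n.bracket_add_left n.bracket_add_right n.a_closed)
  ultimately show "add_map (lie_bracket (lie_direct_sum N1 N2) p q) =
      lie_bracket N (add_map p) (add_map q)"
    by (simp add: add add_map_def direct_sum_simps)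
qed (auto simp: add_map_def direct_sum_simps graph_lie_algebra_simps basis_Un algebra_simps)

lemma add_map_surj: "add_map ` carrier (lie_direct_sum N1 N2) = carrier N"
proof (intro equalityI subsetI)
  fix f assume "f \<in> add_map ` carrier (lie_direct_sum N1 N2)"
  then show "f \<in> carrier N" using lie_homD(1)[OF add_map_hom] by auto
next
  fix f assume f: "f \<in> carrier N"
  \<comment> \<open>Coordinates at shared colors could be split in many ways; here they go entirely
    to the first component.\<close>
  let ?p = "(\<lambda>x. if x \<in> B1 then f x else 0, \<lambda>x. if x \<in> B1 then 0 else f x)"
  have "?p \<in> carrier (lie_direct_sum N1 N2)" "f = add_map ?p"
    using f by (auto simp: direct_sum_simps add_map_def graph_lie_algebra_simps basis_Un)
  then show "f \<in> add_map ` carrier (lie_direct_sum N1 N2)" by blast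
qed

text \<open>A zero sum forces the second component to be the negative of the first, so the first
  vanishes outside \<open>B1\<close> as well as outside \<open>B2\<close>, leaving only the shared
  colors.\<close>

lemma add_map_kernel:
  "lie_kernel (lie_direct_sum N1 N2) N add_map =
    {(f, \<lambda>x. - f x) | f. \<forall>x. x \<notin> Inr ` (S1 \<inter> S2) \<longrightarrow> f x = 0}" (is "?K = ?R")
proof (intro equalityI subsetI)
  fix p assume "p \<in> ?K"
  then have p: "\<And>x. x \<notin> B1 \<Longrightarrow> fst p x = 0" "\<And>x. x \<notin> B2 \<Longrightarrow> snd p x = 0"
      and "\<And>x. fst p x + snd p x = 0"
    by (auto simp: lie_kernel_def direct_sum_simps add_map_def graph_lie_algebra_simps fun_eq_iff)
  then have neg: "\<And>x. snd p x = - fst p x" by (simp add: add_eq_0_iff)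
  have "fst p x = 0" if "x \<notin> Inr ` (S1 \<inter> S2)" for x
    using that p neg[of x] by (auto simp: basis_Int[symmetric])
  moreover have "p = (fst p, \<lambda>x. - fst p x)"
    by (simp add: prod_eq_iff fun_eq_iff neg)
  ultimately show "p \<in> ?R" by blast
next
  fix p assume "p \<in> ?R"
  then show "p \<in> ?K"
    by (auto simp: lie_kernel_def direct_sum_simps add_map_def graph_lie_algebra_simps
        basis_Int[symmetric])
qed

text \<open>The kernel is a submodule containing the generators, hence contains their span.
  Conversely, a pair \<open>(f, -f)\<close> is a combination of generators, by induction on a finite
  set of shared colors supporting \<open>f\<close>.\<close>

lemma add_map_kernel_span:
  "lie_kernel (lie_direct_sum N1 N2) N add_map =
    LinearCombinations.module.span class_ring (lie_direct_sum N1 N2)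
      {(basis_vec (Inr z), \<ominus>\<^bsub>N2\<^esub> basis_vec (Inr w)) | z w. z \<in> S1 \<and> w \<in> S2 \<and> z = w}"
  (is "?K = LinearCombinations.module.span _ ?D ?X")
proof -
  interpret D: lie_algebra ?D by (rule lie_algebra_direct_sum)
  \<comment> \<open>Since \<open>z = w\<close>, one index suffices; membership of \<open>z\<close>
    in \<open>S2\<close> places the basis vector in \<open>N2\<close>, where its inverse is the
    pointwise negative.\<close>
  have X: "?X = {(basis_vec (Inr z), \<lambda>x. - basis_vec (Inr z) x) | z. z \<in> S1 \<inter> S2}"
  proof -
    have "\<ominus>\<^bsub>N2\<^esub> basis_vec (Inr z) = (\<lambda>x. - basis_vec (Inr z) x)" if "z \<in> S2" for z
      by (rule graph_lie_algebra_minus[OF lie_algebra_n2])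
         (use that in \<open>auto simp: graph_lie_algebra_simps graph_basis_def basis_vec_def\<close>)
    then show ?thesis by force
  qed
  have XK: "?X \<subseteq> ?K"
    unfolding X add_map_kernel by (auto simp: basis_vec_def)
  have Xc: "?X \<subseteq> carrier ?D"
    using XK by (auto simp: lie_kernel_def)
  have sub: "LinearCombinations.submodule class_ring (D.span ?X) ?D"
    by (rule D.span_is_submodule[OF Xc])
  have "D.span ?X \<subseteq> ?K"
    by (rule D.span_is_subset[OF XK lie_kernel_submodule[OF lie_algebra_direct_sum lie_algebra_n add_map_hom]])
  moreover have "?K \<subseteq> D.span ?X"
  proof -
    \<comment> \<open>The support is bounded by an arbitrary finite \<open>C\<close> instead of
      \<open>S1 \<inter> S2\<close>, so that induction on \<open>C\<close> with \<open>f\<close>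
      varying is possible.\<close>
    have "(f, \<lambda>x. - f x) \<in> D.span ?X"
      if "finite C" "C \<subseteq> S1 \<inter> S2" "\<forall>x. x \<notin> Inr ` C \<longrightarrow> f x = 0" for f C
      using that
    proof (induction C arbitrary: f)
      case empty
      then have "f = (\<lambda>x. 0)" by auto
      then show ?case
        using submodule.zero_closed[OF sub] by (simp add: direct_sum_simps)
    next
      case (insert z C)
      \<comment> \<open>Clearing the coordinate at \<open>z\<close> leaves support in
        \<open>C\<close>; adding \<open>f (Inr z)\<close> times the generator \<open>?e\<close>
        restores it.\<close>
      let ?g = "f(Inr z := 0)"
      let ?e = "(basis_vec (Inr z), \<lambda>x. - basis_vec (Inr z) x) :: ('v + 's \<Rightarrow> real) \<times> _"
      have "(?g, \<lambda>x. - ?g x) \<in> D.span ?X"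
        using insert.prems by (intro insert.IH) auto
      moreover have "?e \<in> D.span ?X"
        using D.in_own_span[OF Xc] insert.prems(1) unfolding X by blast
      ultimately have "(f (Inr z) \<odot>\<^bsub>?D\<^esub> ?e) \<oplus>\<^bsub>?D\<^esub> (?g, \<lambda>x. - ?g x) \<in> D.span ?X"
        by (intro submodule.m_closed[OF sub] submodule.smult_closed[OF sub]) simp_all
      moreover have "(f (Inr z) \<odot>\<^bsub>?D\<^esub> ?e) \<oplus>\<^bsub>?D\<^esub> (?g, \<lambda>x. - ?g x) = (f, \<lambda>x. - f x)"
        by (auto simp: direct_sum_simps basis_vec_def fun_eq_iff)
      ultimately show ?case by simp
    qed
    moreover have "finite (S1 \<inter> S2)"
      using c1 G1.pair_finite_arcs by auto
    ultimately show ?thesis by (auto simp: add_map_kernel)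
  qed
  ultimately show ?thesis by blast
qed

section \<open>Disjoint color sets\<close>

lemma add_map_kernel_trivial:
  assumes "S1 \<inter> S2 = {}"
  shows "lie_kernel (lie_direct_sum N1 N2) N add_map = {\<zero>\<^bsub>lie_direct_sum N1 N2\<^esub>}"
  unfolding add_map_kernel direct_sum_simps assms by (auto simp: fun_eq_iff)

lemma lie_isomorphic_direct_sum:
  assumes "S1 \<inter> S2 = {}"
  shows "lie_isomorphic N (lie_direct_sum N1 N2)"
\<comment> \<open>The addition map runs from the direct sum to \<open>N\<close>, opposite to the
  claim.\<close>
proof (rule lie_isomorphic_sym[OF lie_algebra_direct_sum])
  have "inj_on add_map (carrier (lie_direct_sum N1 N2))"
    by (rule lie_hom_inj_on[OF lie_algebra_direct_sum lie_algebra_n add_map_hom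
          add_map_kernel_trivial[OF assms]])
  then have "add_map \<in> lie_iso (lie_direct_sum N1 N2) N"
    by (simp add: lie_iso_iff add_map_hom bij_betw_def add_map_surj)
  then show "lie_isomorphic (lie_direct_sum N1 N2) N" by (auto simp: lie_isomorphic_def)
qed

end

theorem proposition4p17:
  fixes G1 G2 :: "'v pair_pre_digraph"
    and c1 c2 :: "'v \<times> 'v \<Rightarrow> 's"
    and S1 S2 :: "'s set"
    and q1 q2 p1 p2 :: nat
    and n1 n2 n :: "('v + 's \<Rightarrow> real) lie_alg"
    and i :: "(('v + 's \<Rightarrow> real) \<times> ('v + 's \<Rightarrow> real)) set"
  assumes "oriented_graph G1" and "oriented_graph G2"
    and "card (pverts G1) = q1" and "card (pverts G2) = q2"
    and "proper_edge_coloring G1 c1" and "proper_edge_coloring G2 c2"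
    and "c1 ` parcs G1 = S1" and "c2 ` parcs G2 = S2"
    and "card S1 = p1" and "card S2 = p2"
    and "pverts G1 \<inter> pverts G2 = {}"
    and "n1 = graph_lie_algebra G1 S1 c1"
    and "n2 = graph_lie_algebra G2 S2 c2"
    and "n = graph_lie_algebra (graph_sum G1 G2) (S1 \<union> S2) (sum_coloring G1 c1 c2)"
    and "i = (if S1 \<inter> S2 \<noteq> {}
              then LinearCombinations.module.span class_ring (lie_direct_sum n1 n2)
                     {(basis_vec (Inr z), \<ominus>\<^bsub>n2\<^esub> basis_vec (Inr w)) | z w.
                        z \<in> S1 \<and> w \<in> S2 \<and> z = w}
              else {(\<zero>\<^bsub>n1\<^esub>, \<zero>\<^bsub>n2\<^esub>)})"
  shows "lie_ideal i (lie_direct_sum n1 n2) \<and>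
    lie_isomorphic n (lie_quotient (lie_direct_sum n1 n2) i) \<and>
    (S1 \<inter> S2 = {} \<longrightarrow> lie_isomorphic n (lie_direct_sum n1 n2))"
proof -
  interpret disjoint_colored_graphs G1 G2 c1 c2 S1 S2
    using assms by (simp add: disjoint_colored_graphs_def disjoint_colored_graphs_axioms_def)
  \<comment> \<open>Both branches of \<open>i\<close> are this kernel: it is zero when no color is
    shared, and the span of the generators otherwise.\<close>
  have "i = lie_kernel (lie_direct_sum N1 N2) N add_map"
  proof (cases "S1 \<inter> S2 = {}")
    case True
    then show ?thesis
      using assms(12-15) add_map_kernel_trivial
      by (simp add: direct_sum_simps graph_lie_algebra_simps)
  next
    case False
    then show ?thesis
      using assms(12-15) add_map_kernel_span by simp
  qed
  then show ?thesis
    using lie_kernel_ideal[OF lie_algebra_direct_sum lie_algebra_n add_map_hom]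
      lie_isomorphic_quotient_kernel[OF lie_algebra_direct_sum lie_algebra_n add_map_hom add_map_surj]
      lie_isomorphic_direct_sum assms(12-14)
    by simp
qed

end
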